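(* Let $n \geq 3$. In the game PAP with pattern length $k=3$, the Sprague--Grundy value of the starting position $S_n$ is $0$; that is, $\operatorname{sg}(S_n,3)=0$, so $S_n$ is a P-position (the second player wins).
   Context: $S_n$ is the set of permutations of $\{1,\dots,n\}$ in one-line notation. A permutation $\pi\in S_n$ contains a pattern $p\in S_k$ if some subsequence $\pi(i_1)\cdots\pi(i_k)$ with $i_1<\cdots<i_k$ is order-isomorphic to $p$; otherwise $\pi$ avoids $p$. The impartial game PAP (Permutations Avoiding Patterns) with pattern length $k$: a position is a subset $X\subseteq S_n$; a move consists of choosing a pattern $p\in S_k$ that is contained in at least one permutation of $X$, and replacing $X$ by the set of permutations in $X$ avoiding $p$. Play is normal play (a player with no legal move loses). The followers of $X$ are the positions reachable in one move, and the Sprague--Grundy value is defined recursively by $\operatorname{sg}(X)=\operatorname{mex}\{\operatorname{sg}(Y): Y \text{ a follower of } X\}$ (mex = least non-negative integer not in the set; terminal positions have value $0$). $\operatorname{sg}(S_n,k)$ denotes the Sprague--Grundy value of the starting position $S_n$ in PAP with pattern length $k$. A position is a P-position iff its value is $0$. *)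

theory Defs
  imports "HOL-Combinatorics.Multiset_Permutations" "HOL-Library.Sublist"
begin

text \<open>
  A permutation is the list of its values in one-line notation; thus \<open>S n\<close> is the set of
  distinct lists with entries exactly \<open>1, \<dots>, n\<close>.
\<close>

definition S :: "nat \<Rightarrow> nat list set" where
  "S n = permutations_of_set {1..n}"

definition order_isomorphic :: "nat list \<Rightarrow> nat list \<Rightarrow> bool" where
  "order_isomorphic xs ys \<longleftrightarrow>
     length xs = length ys \<and>
     (\<forall>i<length xs. \<forall>j<length xs. xs ! i < xs ! j \<longleftrightarrow> ys ! i < ys ! j)"

definition contains :: "nat list \<Rightarrow> nat list \<Rightarrow> bool" where
  "contains \<pi> p \<longleftrightarrow> (\<exists>xs. subseq xs \<pi> \<and> order_isomorphic xs p)"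

definition avoids :: "nat list \<Rightarrow> nat list \<Rightarrow> bool" where
  "avoids \<pi> p \<longleftrightarrow> \<not> contains \<pi> p"

definition followers :: "nat \<Rightarrow> nat list set \<Rightarrow> nat list set set" where
  "followers k X = {{\<pi> \<in> X. avoids \<pi> p} | p. p \<in> S k \<and> (\<exists>\<pi>\<in>X. contains \<pi> p)}"

definition mex :: "nat set \<Rightarrow> nat" where
  "mex A = (LEAST m. m \<notin> A)"

text \<open>
  Every move strictly decreases the number of patterns of length \<open>k\<close> that are still contained
  in some permutation of the position. Hence play terminates from every set of lists, and no
  side condition on the positions is needed in the recursion below.
\<close>

definition playable :: "nat \<Rightarrow> nat list set \<Rightarrow> nat list set" where
  "playable k X = {p \<in> S k. \<exists>\<pi>\<in>X. contains \<pi> p}"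

lemma finite_S: "finite (S n)"
  by (simp add: S_def)

lemma finite_playable: "finite (playable k X)"
  by (simp add: playable_def finite_S)

lemma card_playable_less:
  assumes "Y \<in> followers k X"
  shows "card (playable k Y) < card (playable k X)"
proof (rule psubset_card_mono[OF finite_playable])
  from assms obtain p where "p \<in> S k" "\<exists>\<pi>\<in>X. contains \<pi> p" "Y = {\<pi> \<in> X. avoids \<pi> p}"
    by (auto simp: followers_def)
  then show "playable k Y \<subset> playable k X"
    by (auto simp: playable_def avoids_def)
qed

lemma finite_followers: "finite (followers k X)"
proof -
  have "followers k X = (\<lambda>p. {\<pi> \<in> X. avoids \<pi> p}) ` playable k X"
    by (auto simp: followers_def playable_def)
  then show ?thesis
    by (simp add: finite_playable)
qed

function sg :: "nat \<Rightarrow> nat list set \<Rightarrow> nat" where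
  "sg k X = mex (sg k ` followers k X)"
  by auto
termination
  by (relation "measure (\<lambda>(k, X). card (playable k X))") (auto intro: card_playable_less)

declare sg.simps [simp del]

text \<open>
  Normal play: the second player wins from \<open>X\<close> iff every move from \<open>X\<close> has a reply leading
  to a position from which the second player wins again. In particular, terminal positions are
  P-positions. The lemma \<open>P_position_iff_sg\<close> below shows that these are exactly the positions
  of value \<open>0\<close>.
\<close>

inductive P_position :: "nat \<Rightarrow> nat list set \<Rightarrow> bool" for k where
  "(\<And>Y. Y \<in> followers k X \<Longrightarrow> \<exists>Z\<in>followers k Y. P_position k Z) \<Longrightarrow> P_position k X"

lemma mex_eq_0_iff:
  assumes "finite A"
  shows "mex A = 0 \<longleftrightarrow> 0 \<notin> A"
proof -
  obtain m where "m \<notin> A"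
    using ex_new_if_finite[OF infinite_UNIV_nat assms] by blast
  then have "mex A \<notin> A"
    unfolding mex_def by (rule LeastI)
  moreover have "mex A = 0" if "0 \<notin> A"
    unfolding mex_def using that by (simp add: Least_eq_0)
  ultimately show ?thesis
    by auto
qed

lemma sg_eq_0_iff: "sg k X = 0 \<longleftrightarrow> (\<forall>Y\<in>followers k X. sg k Y \<noteq> 0)"
  unfolding sg.simps[of k X] by (auto simp: mex_eq_0_iff finite_followers image_iff)

lemma P_position_iff_sg: "P_position k X \<longleftrightarrow> sg k X = 0"
proof
  assume "P_position k X"
  then show "sg k X = 0"
  proof induction
    case (1 X)
    then have "\<exists>Z\<in>followers k Y. sg k Z = 0" if "Y \<in> followers k X" for Y
      using that by blast
    then show ?case
      unfolding sg_eq_0_iff[of k X] using sg_eq_0_iff[of k] by blast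
  qed
next
  assume "sg k X = 0"
  then show "P_position k X"
  proof (induction "card (playable k X)" arbitrary: X rule: less_induct)
    case less
    show ?case
    proof (rule P_position.intros)
      fix Y assume Y: "Y \<in> followers k X"
      with less.prems have "sg k Y \<noteq> 0"
        using sg_eq_0_iff[of k X] by blast
      then obtain Z where Z: "Z \<in> followers k Y" "sg k Z = 0"
        using sg_eq_0_iff[of k Y] by auto
      have "card (playable k Z) < card (playable k X)"
        using card_playable_less[OF Y] card_playable_less[OF Z(1)] by simp
      with Z less.hyps show "\<exists>Z\<in>followers k Y. P_position k Z"
        by blast
    qed
  qed
qed

end

theory Submission
  imports Defs
begin

text \<open>
  The second player answers every pattern by its reversal, so that after each of their moves the
  set of forbidden patterns is closed under reversal. It has to be checked that the reversal is
  still contained in some permutation of the position. The identity and the permutations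
  \<open>2, \<dots>, n, 1\<close> and \<open>n, 1, \<dots>, n - 1\<close> contain so few patterns that they, or their reversals, are
  witnesses if \<open>n = 3\<close> or \<open>123\<close> and \<open>321\<close> are allowed. Otherwise \<open>n = 4\<close> by Erdos--Szekeres, and
  \<open>3412\<close> or its reversal is a witness.
\<close>

section \<open>Strategies as invariants\<close>

text \<open>A second-player strategy amounts to a property \<open>I\<close> that some reply restores
  after every opposing move. Induction on the number of playable patterns suffices, since it drops
  with each of the two moves; terminal positions have no followers and need no separate
  case.\<close>

lemma P_position_invariantI:
  assumes "I X"
    and reply: "\<And>X Y. I X \<Longrightarrow> Y \<in> followers k X \<Longrightarrow> \<exists>Z\<in>followers k Y. I Z"
  shows "P_position k X"
  using \<open>I X\<close>
proof (induction "card (playable k X)" arbitrary: X rule: less_induct)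
  case less
  show ?case
  proof (rule P_position.intros)
    fix Y assume Y: "Y \<in> followers k X"
    obtain Z where Z: "Z \<in> followers k Y" "I Z"
      using reply[OF less.prems Y] by blast
    have "card (playable k Z) < card (playable k X)"
      using card_playable_less[OF Y] card_playable_less[OF Z(1)] by simp
    with Z less.hyps show "\<exists>Z\<in>followers k Y. P_position k Z"
      by blast
  qed
qed

section \<open>Reversal symmetry\<close>

lemma order_isomorphic_rev:
  assumes "order_isomorphic xs ys"
  shows "order_isomorphic (rev xs) (rev ys)"
  using assms by (auto simp: order_isomorphic_def rev_nth)

lemma subseq_rev:
  assumes "subseq xs ys"
  shows "subseq (rev xs) (rev ys)"
  using assms by induction (auto intro: list_emb_append_mono subseq_rev_drop_many)

lemma contains_rev [simp]: "contains (rev \<pi>) (rev p) \<longleftrightarrow> contains \<pi> p"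
proof -
  have *: "contains (rev \<pi>) (rev p)" if "contains \<pi> p" for \<pi> p
    using that order_isomorphic_rev unfolding contains_def by (metis subseq_rev)
  show ?thesis
    using *[of \<pi> p] *[of "rev \<pi>" "rev p"] by auto
qed

lemma rev_in_S_iff [simp]: "rev \<pi> \<in> S n \<longleftrightarrow> \<pi> \<in> S n"
  by (simp add: S_def permutations_of_set_def)

lemma length_S: "\<pi> \<in> S n \<Longrightarrow> length \<pi> = n"
  by (auto simp: S_def length_finite_permutations_of_set)

lemma distinct_S: "\<pi> \<in> S n \<Longrightarrow> distinct \<pi>"
  by (auto simp: S_def permutations_of_set_def)

section \<open>Patterns of length three in terms of positions\<close>

lemma S_3: "S 3 = {[1,2,3], [1,3,2], [2,1,3], [2,3,1], [3,1,2], [3,2,1]}"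
proof (intro set_eqI iffI)
  fix xs assume "xs \<in> S 3"
  moreover obtain x y z where xs: "xs = [x, y, z]"
    using length_S[OF \<open>xs \<in> S 3\<close>] by (auto simp: numeral_3_eq_3 length_Suc_conv)
  ultimately have "x \<in> {1..3}" "y \<in> {1..3}" "z \<in> {1..3}" and d: "distinct [x, y, z]"
    by (auto simp: S_def permutations_of_set_def)
  then have "x = 1 \<or> x = 2 \<or> x = 3" "y = 1 \<or> y = 2 \<or> y = 3" "z = 1 \<or> z = 2 \<or> z = 3"
    by auto
  with d show "xs \<in> {[1,2,3], [1,3,2], [2,1,3], [2,3,1], [3,1,2], [3,2,1]}"
    unfolding xs by auto
qed (auto simp: S_def permutations_of_set_def)

lemma order_isomorphic_triple:
  "order_isomorphic [x, y, z] [a, b, c] \<longleftrightarrow>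
     (x < y \<longleftrightarrow> a < b) \<and> (y < x \<longleftrightarrow> b < a) \<and> (x < z \<longleftrightarrow> a < c) \<and> (z < x \<longleftrightarrow> c < a) \<and>
     (y < z \<longleftrightarrow> b < c) \<and> (z < y \<longleftrightarrow> c < b)"
  by (auto simp: order_isomorphic_def All_less_Suc)

text \<open>After the head is matched at position \<open>i\<close>, what remains is again a
  subsequence question about some \<open>drop\<close>. Repeated unfolding therefore turns a
  subsequence into a strictly increasing choice of positions.\<close>

lemma subseq_Cons_drop_iff:
  "subseq (x # xs) (drop m ys) \<longleftrightarrow>
     (\<exists>i\<ge>m. i < length ys \<and> ys ! i = x \<and> subseq xs (drop (Suc i) ys))"
proof
  assume "subseq (x # xs) (drop m ys)"
  then obtain us vs where us: "drop m ys = us @ x # vs" and "subseq xs vs"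
    by (auto dest: list_emb_ConsD)
  have "length us < length (drop m ys)"
    by (simp only: us) simp
  moreover have "drop m ys ! length us = x" "drop (Suc (length us)) (drop m ys) = vs"
    by (simp_all only: us) simp_all
  ultimately show "\<exists>i\<ge>m. i < length ys \<and> ys ! i = x \<and> subseq xs (drop (Suc i) ys)"
    using \<open>subseq xs vs\<close> by (intro exI[of _ "m + length us"]) (auto simp: add.commute)
next
  assume "\<exists>i\<ge>m. i < length ys \<and> ys ! i = x \<and> subseq xs (drop (Suc i) ys)"
  then obtain i where i: "m \<le> i" "i < length ys" "ys ! i = x" "subseq xs (drop (Suc i) ys)"
    by blast
  then have "subseq (x # xs) (drop i ys)"
    by (simp flip: Cons_nth_drop_Suc)
  moreover have "drop i ys = drop (i - m) (drop m ys)"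
    using i(1) by simp
  ultimately show "subseq (x # xs) (drop m ys)"
    by (metis append_take_drop_id list_emb_append2)
qed

lemma contains_triple_iff:
  "contains \<pi> [a, b, c] \<longleftrightarrow>
     (\<exists>i j k. i < j \<and> j < k \<and> k < length \<pi> \<and> order_isomorphic [\<pi> ! i, \<pi> ! j, \<pi> ! k] [a, b, c])"
    (is "?L \<longleftrightarrow> ?R")
proof
  assume ?L
  then obtain xs where xs: "subseq xs \<pi>" "order_isomorphic xs [a, b, c]"
    by (auto simp: contains_def)
  then have "length xs = 3"
    by (simp add: order_isomorphic_def)
  then obtain x y z where xyz: "xs = [x, y, z]"
    by (auto simp: numeral_3_eq_3 length_Suc_conv)
  have "subseq [x, y, z] (drop 0 \<pi>)"
    using xs(1) xyz by simp
  then show ?R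
    using xs(2) unfolding xyz subseq_Cons_drop_iff by (auto simp: Suc_le_eq)
next
  assume ?R
  then obtain i j k where ijk: "i < j" "j < k" "k < length \<pi>"
      and iso: "order_isomorphic [\<pi> ! i, \<pi> ! j, \<pi> ! k] [a, b, c]"
    by blast
  have "subseq [\<pi> ! i, \<pi> ! j, \<pi> ! k] (drop 0 \<pi>)"
    unfolding subseq_Cons_drop_iff using ijk
    by (intro exI[of _ i] conjI exI[of _ j] exI[of _ k]) auto
  with iso show ?L
    by (auto simp: contains_def)
qed

lemma contains_tripleI:
  assumes "i < j" "j < k" "k < length \<pi>" "order_isomorphic [\<pi> ! i, \<pi> ! j, \<pi> ! k] [a, b, c]"
  shows "contains \<pi> [a, b, c]"
  using assms unfolding contains_triple_iff by blast

section \<open>Monotone triples, peaks and valleys\<close>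

text \<open>Erdos-Szekeres for 5 = 2 * 2 + 1. The first five entries are few enough to compare in
  all ten triples directly.\<close>

lemma contains_monotone_triple:
  assumes "distinct \<pi>" and "length \<pi> \<ge> 5"
  shows "contains \<pi> [1,2,3] \<or> contains \<pi> [3,2,1]"
proof (rule ccontr)
  assume neg: "\<not> ?thesis"
  have *: "\<not> (\<pi> ! i < \<pi> ! j \<and> \<pi> ! j < \<pi> ! k)" "\<not> (\<pi> ! k < \<pi> ! j \<and> \<pi> ! j < \<pi> ! i)"
    if "i < j" "j < k" "k < 5" for i j k
    using that assms(2) neg contains_tripleI[of i j k \<pi> 1 2 3]
      contains_tripleI[of i j k \<pi> 3 2 1]
    by (auto simp: order_isomorphic_triple)
  have neq: "\<pi> ! i \<noteq> \<pi> ! j" if "i < j" "j < 5" for i j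
    using that assms by (simp add: nth_eq_iff_index_eq)
  show False
    using *[of 0 1 2] *[of 0 1 3] *[of 0 1 4] *[of 0 2 3] *[of 0 2 4] *[of 0 3 4]
      *[of 1 2 3] *[of 1 2 4] *[of 1 3 4] *[of 2 3 4]
      neq[of 0 1] neq[of 0 2] neq[of 0 3] neq[of 0 4] neq[of 1 2] neq[of 1 3] neq[of 1 4]
      neq[of 2 3] neq[of 2 4] neq[of 3 4]
    by simp (smt (verit) linorder_neqE_nat)
qed

text \<open>Without monotone triples, ascents and descents alternate. Four entries have three
  consecutive steps, hence both a peak (132 or 231) and a valley (213 or 312).\<close>

lemma contains_of_length_4:
  assumes "distinct \<pi>" and "length \<pi> = 4"
    and "\<not> contains \<pi> [1,2,3]" and "\<not> contains \<pi> [3,2,1]"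
  shows "contains \<pi> [1,3,2] \<or> contains \<pi> [2,3,1]"
    and "contains \<pi> [2,1,3] \<or> contains \<pi> [3,1,2]"
proof -
  have mono: "\<not> (\<pi> ! i < \<pi> ! j \<and> \<pi> ! j < \<pi> ! k)" "\<not> (\<pi> ! k < \<pi> ! j \<and> \<pi> ! j < \<pi> ! i)"
    if "i < j" "j < k" "k < 4" for i j k
    using that assms(2-4) contains_tripleI[of i j k \<pi> 1 2 3]
      contains_tripleI[of i j k \<pi> 3 2 1]
    by (auto simp: order_isomorphic_triple)
  have neq: "\<pi> ! i \<noteq> \<pi> ! j" if "i < j" "j < 4" for i j
    using that assms by (simp add: nth_eq_iff_index_eq)
  note facts = mono[of 0 1 2] mono[of 0 1 3] mono[of 0 2 3] mono[of 1 2 3]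
    neq[of 0 1] neq[of 0 2] neq[of 0 3] neq[of 1 2] neq[of 1 3] neq[of 2 3]
  show "contains \<pi> [1,3,2] \<or> contains \<pi> [2,3,1]"
  proof (rule ccontr)
    assume neg: "\<not> ?thesis"
    \<comment> \<open>No triple is a peak: the order of its two distinct ends would decide between
      132 and 231.\<close>
    have *: "\<not> (\<pi> ! i < \<pi> ! j \<and> \<pi> ! k < \<pi> ! j \<and> \<pi> ! i \<noteq> \<pi> ! k)"
      if "i < j" "j < k" "k < 4" for i j k
      using that assms(2) neg contains_tripleI[of i j k \<pi> 1 3 2]
      contains_tripleI[of i j k \<pi> 2 3 1]
      by (auto simp: order_isomorphic_triple neq_iff)
    show False
      using facts *[of 0 1 2] *[of 0 1 3] *[of 0 2 3] *[of 1 2 3] by simp (smt (verit) linorder_neqE_nat)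
  qed
  show "contains \<pi> [2,1,3] \<or> contains \<pi> [3,1,2]"
  proof (rule ccontr)
    assume neg: "\<not> ?thesis"
    have *: "\<not> (\<pi> ! j < \<pi> ! i \<and> \<pi> ! j < \<pi> ! k \<and> \<pi> ! i \<noteq> \<pi> ! k)"
      if "i < j" "j < k" "k < 4" for i j k
      using that assms(2) neg contains_tripleI[of i j k \<pi> 2 1 3]
      contains_tripleI[of i j k \<pi> 3 1 2]
      by (auto simp: order_isomorphic_triple neq_iff)
    show False
      using facts *[of 0 1 2] *[of 0 1 3] *[of 0 2 3] *[of 1 2 3] by simp (smt (verit) linorder_neqE_nat)
  qed
qed

section \<open>Witnesses with few patterns\<close>

lemma identity_contains_iff:
  assumes "n \<ge> 3" and "q \<in> S 3"
  shows "contains [1..<Suc n] q \<longleftrightarrow> q = [1,2,3]"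
proof -
  have "contains [1..<Suc n] [1,2,3]"
    unfolding contains_triple_iff using assms(1)
    by (intro exI[of _ 0] exI[of _ 1] exI[of _ 2])
      (auto simp: order_isomorphic_triple simp del: upt_Suc)
  moreover have "q = [1,2,3]" if "contains [1..<Suc n] q"
    using assms(2) that
    by (auto simp: S_3 contains_triple_iff order_isomorphic_triple simp del: upt_Suc)
  ultimately show ?thesis
    by blast
qed

text \<open>Triples ending in the final 1 form 231; all others are increasing and lie within the
  first \<open>n - 1\<close> entries, so they need \<open>n \<ge> 4\<close>.\<close>

lemma append_one_contains:
  assumes "n \<ge> 3"
  shows "[2..<Suc n] @ [1] \<in> S n"
    and "contains ([2..<Suc n] @ [1]) [2,3,1]"
    and "q \<in> S 3 \<Longrightarrow> contains ([2..<Suc n] @ [1]) q \<Longrightarrow> q = [2,3,1] \<or> q = [1,2,3] \<and> n \<ge> 4"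
proof -
  show "[2..<Suc n] @ [1] \<in> S n"
    using assms by (auto simp: S_def permutations_of_set_def simp del: upt_Suc)
  show "contains ([2..<Suc n] @ [1]) [2,3,1]"
    unfolding contains_triple_iff using assms
    by (intro exI[of _ 0] exI[of _ 1] exI[of _ "n - 1"])
      (auto simp: order_isomorphic_triple nth_append simp del: upt_Suc)
  show "q = [2,3,1] \<or> q = [1,2,3] \<and> n \<ge> 4" if "q \<in> S 3" "contains ([2..<Suc n] @ [1]) q"
    using that assms
    by (auto simp: S_3 contains_triple_iff order_isomorphic_triple nth_append
        simp del: upt_Suc split: if_splits)
qed

text \<open>This witness is the reverse-complement of the preceding one: triples through the leading
  \<open>n\<close> form 312, all others are increasing.\<close>

lemma Cons_max_contains:
  assumes "n \<ge> 3"
  shows "n # [1..<n] \<in> S n"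
    and "contains (n # [1..<n]) [3,1,2]"
    and "q \<in> S 3 \<Longrightarrow> contains (n # [1..<n]) q \<Longrightarrow> q = [3,1,2] \<or> q = [1,2,3] \<and> n \<ge> 4"
proof -
  show "n # [1..<n] \<in> S n"
    using assms by (auto simp: S_def permutations_of_set_def)
  show "contains (n # [1..<n]) [3,1,2]"
    unfolding contains_triple_iff using assms
    by (intro exI[of _ 0] exI[of _ 1] exI[of _ 2])
      (auto simp: order_isomorphic_triple nth_Cons')
  show "q = [3,1,2] \<or> q = [1,2,3] \<and> n \<ge> 4" if "q \<in> S 3" "contains (n # [1..<n]) q"
    using that assms
    by (auto simp: S_3 contains_triple_iff order_isomorphic_triple nth_Cons' split: if_splits)
qed

text \<open>The set for \<open>p\<close> has one pattern from each reversal pair, chosen so that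
  \<open>rev p\<close> is 123, 231 or 312, the characteristic patterns of the three witnesses
  above.\<close>

lemma ex_permutation_few_patterns:
  assumes n: "n \<ge> 3" and p: "p \<in> {[3,2,1], [1,3,2], [2,1,3]}"
  shows "\<exists>\<sigma>\<in>S n. contains \<sigma> (rev p) \<and>
           (\<forall>q\<in>S 3. contains \<sigma> q \<longrightarrow> q = rev p \<or> q = [1,2,3] \<and> n \<ge> 4)"
proof -
  consider "p = [3,2,1]" | "p = [1,3,2]" | "p = [2,1,3]"
    using p by blast
  then show ?thesis
  proof cases
    case 1
    have "[1..<Suc n] \<in> S n"
      by (auto simp: S_def permutations_of_set_def)
    moreover have "rev p = [1,2,3]"
      using 1 by simp
    moreover have "[1,2,3] \<in> S 3"
      by (simp add: S_3)
    ultimately show ?thesis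
      using identity_contains_iff[OF n] by metis
  next
    case 2
    then have "rev p = [2,3,1]"
      by simp
    then show ?thesis
      using append_one_contains[OF n] by metis
  next
    case 3
    then have "rev p = [3,1,2]"
      by simp
    then show ?thesis
      using Cons_max_contains[OF n] by metis
  qed
qed

text \<open>The triples 341 and 342 form 231, while 312 and 412 form 312.\<close>

lemma contains_3412_iff:
  assumes "q \<in> S 3"
  shows "contains [3,4,1,2] q \<longleftrightarrow> q = [2,3,1] \<or> q = [3,1,2]"
proof -
  \<comment> \<open>Listing all subsequences makes the existential a finite check.\<close>
  have "contains [3,4,1,2] q \<longleftrightarrow> (\<exists>xs\<in>set (subseqs [3,4,1,2]). order_isomorphic xs q)"
    by (simp only: contains_def Bex_def in_set_subseqs)
  then show ?thesis
    using assms unfolding S_3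
    by (elim insertE emptyE; simp add: Let_def order_isomorphic_triple)
      (simp_all add: order_isomorphic_def)
qed

lemma perm_3412_in_S: "[3,4,1,2] \<in> S 4"
  by (auto simp: S_def permutations_of_set_def)

section \<open>Replies by reversal\<close>

text \<open>The position reached from \<open>S n\<close> once the patterns in \<open>Q\<close> have
  been played; a further move inserts one pattern into \<open>Q\<close>.\<close>

definition avoiders :: "nat \<Rightarrow> nat list set \<Rightarrow> nat list set" where
  "avoiders n Q = {\<pi> \<in> S n. \<forall>q\<in>Q. avoids \<pi> q}"

lemma avoiders_insert: "avoiders n (insert p Q) = {\<pi> \<in> avoiders n Q. avoids \<pi> p}"
  by (auto simp: avoiders_def)

lemma rev_in_avoiders:
  assumes "rev ` Q \<subseteq> Q" and "\<pi> \<in> avoiders n Q"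
  shows "rev \<pi> \<in> avoiders n Q"
proof -
  have "avoids (rev \<pi>) q" if "q \<in> Q" for q
  proof -
    have "rev q \<in> Q"
      using assms(1) that by blast
    then show ?thesis
      using assms(2) contains_rev[of \<pi> "rev q"] by (auto simp: avoiders_def avoids_def)
  qed
  with assms(2) show ?thesis
    by (simp add: avoiders_def)
qed

text \<open>The permutation \<open>\<sigma>\<close> survives the move \<open>p\<close> and makes
  \<open>rev p\<close> a legal answer. Here \<open>p\<close> is restricted to one representative of
  each reversal pair.\<close>

lemma reply_avoider_aux:
  assumes n: "n \<ge> 3" and Q: "Q \<subseteq> S 3" "rev ` Q \<subseteq> Q"
    and p: "p \<in> {[3,2,1], [1,3,2], [2,1,3]}"
    and \<pi>: "\<pi> \<in> avoiders n Q" "contains \<pi> p"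
  shows "\<exists>\<sigma>\<in>avoiders n Q. avoids \<sigma> p \<and> contains \<sigma> (rev p)"
proof -
  have pS: "p \<in> S 3"
    using p by (auto simp: S_3)
  have pQ: "p \<notin> Q"
    using \<pi> by (auto simp: avoiders_def avoids_def)
  have rQ: "rev q \<in> Q \<longleftrightarrow> q \<in> Q" for q
    using Q(2) by (metis image_subset_iff rev_rev_ident)
  have rpQ: "rev p \<notin> Q"
    using pQ rQ by simp
  have avoidersI: "\<sigma> \<in> avoiders n Q" if "\<sigma> \<in> S n" "\<And>q. q \<in> S 3 \<Longrightarrow> contains \<sigma> q \<Longrightarrow> q \<notin> Q" for \<sigma>
    using that Q(1) by (auto simp: avoiders_def avoids_def)
  \<comment> \<open>For \<open>n = 3\<close> the witness contains no pattern besides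
    \<open>rev p\<close>, so it does no harm if 123 is forbidden.\<close>
  consider (free) "[1,2,3] \<notin> Q \<or> n = 3" | (forbidden) "[1,2,3] \<in> Q" "n \<ge> 4"
    using n by linarith
  then show ?thesis
  proof cases
    case free
    obtain \<sigma> where \<sigma>: "\<sigma> \<in> S n" "contains \<sigma> (rev p)"
      and only: "\<And>q. q \<in> S 3 \<Longrightarrow> contains \<sigma> q \<Longrightarrow> q = rev p \<or> q = [1,2,3] \<and> n \<ge> 4"
      using ex_permutation_few_patterns[OF n p] by blast
    have "\<sigma> \<in> avoiders n Q"
      using \<sigma>(1) only rpQ free by (intro avoidersI) auto
    moreover have "avoids \<sigma> p"
      using only[OF pS] p by (auto simp: avoids_def)
    ultimately show ?thesis
      using \<sigma>(2) by blast
  next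
    case forbidden
    have 321: "[3,2,1] \<in> Q"
      using rQ[of "[1,2,3]"] forbidden(1) by simp
    have no: "\<not> contains \<pi> q" if "q \<in> Q" for q
      using \<pi>(1) that by (simp add: avoiders_def avoids_def)
    have dl: "distinct \<pi>" "length \<pi> = n"
      using \<pi>(1) by (auto simp: avoiders_def distinct_S length_S)
    have n4: "n = 4"
      using contains_monotone_triple[of \<pi>] dl no[OF forbidden(1)] no[OF 321] forbidden(2) by force
    \<comment> \<open>If 231 were in \<open>Q\<close>, so would be 132 by closure, and
      \<open>\<pi>\<close> would have no peak; likewise 312 and 213 would leave it without a
      valley.\<close>
    have "[2,3,1] \<notin> Q" "[3,1,2] \<notin> Q"
      using contains_of_length_4[of \<pi>] dl n4 no forbidden(1) 321 rQ[of "[2,3,1]"] rQ[of "[3,1,2]"]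
      by auto
    then have "[3,4,1,2] \<in> avoiders n Q"
      unfolding n4 avoiders_def avoids_def
      using perm_3412_in_S Q(1) contains_3412_iff by blast
    \<comment> \<open>The pattern 321 is already in \<open>Q\<close>, so \<open>p\<close> is one of
      the two whose reversals occur in 3412.\<close>
    moreover have "p = [1,3,2] \<or> p = [2,1,3]"
      using p pQ 321 by auto
    then have "\<not> (p = [2,3,1] \<or> p = [3,1,2])" and "rev p = [2,3,1] \<or> rev p = [3,1,2]"
      by (elim disjE; simp)+
    then have "\<not> contains [3,4,1,2] p" and "contains [3,4,1,2] (rev p)"
      using contains_3412_iff[OF pS] contains_3412_iff[of "rev p"] pS rev_in_S_iff by blast+
    ultimately show ?thesis
      unfolding avoids_def by blast
  qed
qed

text \<open>The other three patterns are reversals of the representatives: the auxiliary result is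
  applied to \<open>rev p\<close> and \<open>rev \<pi>\<close>, and its witness is reversed
  back.\<close>

lemma reply_avoider:
  assumes n: "n \<ge> 3" and Q: "Q \<subseteq> S 3" "rev ` Q \<subseteq> Q"
    and p: "p \<in> S 3" and \<pi>: "\<pi> \<in> avoiders n Q" "contains \<pi> p"
  shows "\<exists>\<sigma>\<in>avoiders n Q. avoids \<sigma> p \<and> contains \<sigma> (rev p)"
proof (cases "p \<in> {[3,2,1], [1,3,2], [2,1,3]}")
  case True
  then show ?thesis
    using reply_avoider_aux[OF n Q _ \<pi>] by blast
next
  case False
  then have "rev p \<in> {[3,2,1], [1,3,2], [2,1,3]}"
    using p by (auto simp: S_3)
  moreover have "contains (rev \<pi>) (rev p)"
    using \<pi>(2) by simp
  ultimately have "\<exists>\<sigma>\<in>avoiders n Q. avoids \<sigma> (rev p) \<and> contains \<sigma> (rev (rev p))"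
    by (rule reply_avoider_aux[OF n Q _ rev_in_avoiders[OF Q(2) \<pi>(1)]])
  then obtain \<sigma> where \<sigma>: "\<sigma> \<in> avoiders n Q" "avoids \<sigma> (rev p)" "contains \<sigma> p"
    by auto
  have "avoids (rev \<sigma>) p" "contains (rev \<sigma>) (rev p)"
    using \<sigma>(2,3) contains_rev[of \<sigma> "rev p"] by (simp_all add: avoids_def)
  with rev_in_avoiders[OF Q(2) \<sigma>(1)] show ?thesis
    by blast
qed

theorem theorem2p5:
  fixes n :: nat
  assumes "n \<ge> 3"
  shows "sg 3 (S n) = 0 \<and> P_position 3 (S n)"
proof -
  \<comment> \<open>The empty \<open>Q\<close> gives the start \<open>S n\<close>; a move
    \<open>p\<close> and its answer \<open>rev p\<close> together keep \<open>Q\<close> closed under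
    reversal.\<close>
  define I where "I X \<longleftrightarrow> (\<exists>Q. Q \<subseteq> S 3 \<and> rev ` Q \<subseteq> Q \<and> X = avoiders n Q)" for X
  have "P_position 3 (S n)"
  proof (rule P_position_invariantI[of I])
    show "I (S n)"
      unfolding I_def by (intro exI[of _ "{}"]) (simp add: avoiders_def)
  next
    fix X Y assume "I X" and Y: "Y \<in> followers 3 X"
    then obtain Q where Q: "Q \<subseteq> S 3" "rev ` Q \<subseteq> Q" and X: "X = avoiders n Q"
      by (auto simp: I_def)
    from Y X obtain p \<pi> where p: "p \<in> S 3" "\<pi> \<in> avoiders n Q" "contains \<pi> p"
        and Y_eq: "Y = avoiders n (insert p Q)"
      by (auto simp: followers_def avoiders_insert)
    let ?Q = "insert (rev p) (insert p Q)"
    obtain \<sigma> where "\<sigma> \<in> Y" "contains \<sigma> (rev p)"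
      using reply_avoider[OF assms Q p] unfolding Y_eq avoiders_insert by blast
    moreover have "rev p \<in> S 3"
      using p(1) by simp
    moreover have "avoiders n ?Q = {\<pi> \<in> Y. avoids \<pi> (rev p)}"
      by (simp add: Y_eq avoiders_insert)
    ultimately have "avoiders n ?Q \<in> followers 3 Y"
      unfolding followers_def by blast
    moreover have "I (avoiders n ?Q)"
      unfolding I_def using Q p(1) by (intro exI[of _ ?Q]) auto
    ultimately show "\<exists>Z\<in>followers 3 Y. I Z"
      by blast
  qed
  then show ?thesis
    by (simp add: P_position_iff_sg)
qed

end
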